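(* Let $\mathcal{A}$ be a finite-dimensional real associative unital algebra with a norm, let $U$ be an open connected subset of $\mathcal{A}$, and let $f_n:U\to\mathcal{A}$ be $\mathcal{A}$-differentiable on $U$ for each $n\in\mathbb{N}$. Suppose that (i) there exists a point $z_0\in U$ such that the sequence $\{f_n(z_0)\}$ converges in $\mathcal{A}$, and (ii) for every $a\in U$ there is an open ball $B(a)$ centered at $a$, contained in $U$, on which the sequence of derivatives $\{f_n'\}$ converges uniformly. Then for each $a\in U$ the sequence $\{f_n\}$ converges uniformly on $B(a)$; moreover, setting $f(z)=\lim_{n\to\infty}f_n(z)$ and $g(z)=\lim_{n\to\infty}f_n'(z)$ for $z\in U$, the function $f$ is $\mathcal{A}$-differentiable on $U$ and $f'(z)=g(z)$ for each $z\in U$.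
   Context: A linear map $T:\mathcal{A}\to\mathcal{A}$ is right $\mathcal{A}$-linear if $T(x\star y)=T(x)\star y$ for all $x,y$. A function $f$ on an open set containing $p$ is $\mathcal{A}$-differentiable at $p$ if there is a right $\mathcal{A}$-linear map $d_pf$ with $\lim_{h\to0}\frac{f(p+h)-f(p)-d_pf(h)}{\|h\|}=0$ (i.e. $f$ is Fréchet differentiable at $p$ with right $\mathcal{A}$-linear differential). Its $\mathcal{A}$-derivative is $f'(p)=d_pf(1)$, where $1$ is the unit. *)

theory Defs
  imports "HOL-Analysis.Analysis"
begin

definition fin_dim_real :: "'a::real_vector itself \<Rightarrow> bool" where
  "fin_dim_real _ \<longleftrightarrow> (\<exists>B::'a set. finite B \<and> span B = UNIV)"

definition right_A_linear :: "('a::real_algebra_1 \<Rightarrow> 'a) \<Rightarrow> bool" where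
  "right_A_linear T \<longleftrightarrow> linear T \<and> (\<forall>x y. T (x * y) = T x * y)"

definition A_differentiable ::
  "('a::{real_algebra_1,real_normed_vector} \<Rightarrow> 'a) \<Rightarrow> 'a \<Rightarrow> bool" where
  "A_differentiable f p \<longleftrightarrow> (\<exists>T. right_A_linear T \<and> (f has_derivative T) (at p))"

definition A_deriv ::
  "('a::{real_algebra_1,real_normed_vector} \<Rightarrow> 'a) \<Rightarrow> 'a \<Rightarrow> 'a" where
  "A_deriv f p = frechet_derivative f (at p) 1"

end

theory Submission
  imports Defs
begin

text \<open>On a ball the mean value inequality turns uniform convergence of the derivatives into
  a uniform Cauchy estimate for the differences \<open>f\<^sub>n x - f\<^sub>n x\<^sub>0\<close>. Finite dimensionality of the
  algebra supplies completeness and a bound \<open>\<parallel>x y\<parallel> \<le> K \<parallel>x\<parallel> \<parallel>y\<parallel>\<close> (the norm need not be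
  submultiplicative), so convergence at one point of a ball gives uniform convergence on the ball
  to a limit whose differential is \<open>h \<mapsto> g z h\<close>. Hence the set of points of \<open>U\<close> where
  \<open>f\<^sub>n\<close> converges is open and closed in \<open>U\<close>, and it contains \<open>z\<^sub>0\<close>.\<close>

lemma complete_span_if_coefficient_bound:
  fixes B :: "'a::real_normed_vector set"
  assumes B: "finite B" and \<delta>: "\<delta> > 0"
    and bound: "\<And>c. \<delta> * (\<Sum>b\<in>B. \<bar>c b\<bar>) \<le> norm (\<Sum>b\<in>B. c b *\<^sub>R b)"
  shows "complete (span B)"
proof (rule completeI)
  fix X :: "nat \<Rightarrow> 'a"
  assume "\<forall>n. X n \<in> span B" and X: "Cauchy X"
  then have "\<forall>k. \<exists>u. X k = (\<Sum>b\<in>B. u b *\<^sub>R b)"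
    unfolding span_finite[OF B] by blast
  then obtain c where c: "\<And>k. X k = (\<Sum>b\<in>B. c k b *\<^sub>R b)"
    by metis
  have "Cauchy (\<lambda>k. c k b)" if b: "b \<in> B" for b
  proof (rule metric_CauchyI)
    fix e :: real
    assume "e > 0"
    then obtain M where M: "\<forall>m\<ge>M. \<forall>n\<ge>M. dist (X m) (X n) < \<delta> * e"
      using X \<delta> unfolding Cauchy_def by (meson mult_pos_pos)
    show "\<exists>M. \<forall>m\<ge>M. \<forall>n\<ge>M. dist (c m b) (c n b) < e"
    proof (intro exI allI impI)
      fix m n
      assume "M \<le> m" "M \<le> n"
      have "\<delta> * \<bar>c m b - c n b\<bar> \<le> \<delta> * (\<Sum>v\<in>B. \<bar>c m v - c n v\<bar>)"
        using \<delta> b B by (intro mult_left_mono member_le_sum) auto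
      also have "\<dots> \<le> norm (X m - X n)"
        using bound[of "\<lambda>v. c m v - c n v"]
        by (simp add: c scaleR_diff_left sum_subtractf)
      also have "\<dots> < \<delta> * e"
        using M \<open>M \<le> m\<close> \<open>M \<le> n\<close> by (simp add: dist_norm)
      finally show "dist (c m b) (c n b) < e"
        using \<delta> by (simp add: dist_real_def)
    qed
  qed
  then obtain d where d: "\<And>b. b \<in> B \<Longrightarrow> (\<lambda>k. c k b) \<longlonglongrightarrow> d b"
    unfolding Cauchy_convergent_iff convergent_def by metis
  have "X \<longlonglongrightarrow> (\<Sum>b\<in>B. d b *\<^sub>R b)"
    unfolding c by (intro tendsto_sum tendsto_scaleR d tendsto_const)
  moreover have "(\<Sum>b\<in>B. d b *\<^sub>R b) \<in> span B"
    by (simp add: span_sum span_scale span_base)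
  ultimately show "\<exists>l\<in>span B. X \<longlonglongrightarrow> l"
    by blast
qed

lemma norm_scaleR_add_lower_bound:
  fixes a :: "'a::real_normed_vector"
  assumes dist_span: "\<And>y. y \<in> span B \<Longrightarrow> \<eta> \<le> norm (a - y)" and y: "y \<in> span B"
  shows "\<eta> * \<bar>t\<bar> \<le> norm (t *\<^sub>R a + y)"
proof (cases "t = 0")
  case False
  have "- (y /\<^sub>R t) \<in> span B"
    using y by (simp add: span_neg span_scale)
  then have "\<eta> \<le> norm (a - - (y /\<^sub>R t))"
    by (rule dist_span)
  also have "a - - (y /\<^sub>R t) = (t *\<^sub>R a + y) /\<^sub>R t"
    using False by (simp add: algebra_simps)
  also have "norm \<dots> = norm (t *\<^sub>R a + y) / \<bar>t\<bar>"
    by (simp add: divide_inverse_commute)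
  finally show ?thesis
    using False by (simp add: field_simps)
qed (use dist_span[OF span_zero] in simp)

lemma independent_coefficient_bound:
  fixes B :: "'a::real_normed_vector set"
  assumes "finite B" "independent B"
  shows "\<exists>\<delta>>0. \<forall>c. \<delta> * (\<Sum>b\<in>B. \<bar>c b\<bar>) \<le> norm (\<Sum>b\<in>B. c b *\<^sub>R b)"
  using assms
proof (induction B rule: finite_induct)
  case empty
  show ?case by (intro exI[of _ 1]) simp
next
  case (insert a B)
  have "independent B" and a: "a \<notin> span B"
    using insert.prems insert.hyps(2) by (auto simp: independent_insert)
  then obtain \<delta> where \<delta>: "\<delta> > 0"
    and bound: "\<And>c. \<delta> * (\<Sum>b\<in>B. \<bar>c b\<bar>) \<le> norm (\<Sum>b\<in>B. c b *\<^sub>R b)"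
    using insert.IH by blast
  define \<eta> where "\<eta> = infdist a (span B)"
  have "closed (span B)"
    by (rule complete_imp_closed[OF complete_span_if_coefficient_bound[OF insert.hyps(1) \<delta> bound]])
  then have \<eta>: "\<eta> > 0"
    using a in_closed_iff_infdist_zero[of "span B" a] infdist_nonneg[of a "span B"]
    unfolding \<eta>_def by (metis empty_iff less_eq_real_def span_zero)
  have dist_span: "\<eta> \<le> norm (a - y)" if "y \<in> span B" for y
    unfolding \<eta>_def using infdist_le[OF that, of a] by (simp add: dist_norm)
  define K where "K = 1 / \<eta> + (1 + norm a / \<eta>) / \<delta>"
  have K: "K > 0"
    using \<eta> \<delta> unfolding K_def by (simp add: add_pos_nonneg)
  show ?case
  proof (intro exI[of _ "1 / K"] conjI allI)
    fix c :: "'a \<Rightarrow> real"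
    define y where "y = (\<Sum>b\<in>B. c b *\<^sub>R b)"
    define x where "x = c a *\<^sub>R a + y"
    have y: "y \<in> span B"
      unfolding y_def by (simp add: span_sum span_scale span_base)
    have ca: "\<bar>c a\<bar> \<le> norm x / \<eta>"
      using norm_scaleR_add_lower_bound[OF dist_span y, of "c a"] \<eta>
      unfolding x_def by (simp add: field_simps)
    have "\<delta> * (\<Sum>b\<in>B. \<bar>c b\<bar>) \<le> norm (x - c a *\<^sub>R a)"
      using bound[of c] by (simp add: x_def y_def)
    also have "\<dots> \<le> norm x + norm x / \<eta> * norm a"
      using norm_triangle_ineq4[of x "c a *\<^sub>R a"] mult_right_mono[OF ca norm_ge_zero[of a]]
      by simp
    finally have "(\<Sum>b\<in>B. \<bar>c b\<bar>) \<le> (norm x + norm x / \<eta> * norm a) / \<delta>"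
      using \<delta> by (simp add: field_simps)
    moreover have "norm x / \<eta> + (norm x + norm x / \<eta> * norm a) / \<delta> = K * norm x"
      unfolding K_def by (simp add: field_simps)
    ultimately have "\<bar>c a\<bar> + (\<Sum>b\<in>B. \<bar>c b\<bar>) \<le> K * norm x"
      using ca by linarith
    then show "1 / K * (\<Sum>b\<in>insert a B. \<bar>c b\<bar>) \<le> norm (\<Sum>b\<in>insert a B. c b *\<^sub>R b)"
      using K insert.hyps by (simp add: x_def y_def field_simps)
  qed (use K in simp)
qed

lemma fin_dim_real_basis:
  assumes "fin_dim_real TYPE('a)"
  obtains B :: "'a::real_normed_vector set" and \<delta> where "finite B" "span B = UNIV" "\<delta> > 0"
    "\<And>c. \<delta> * (\<Sum>b\<in>B. \<bar>c b\<bar>) \<le> norm (\<Sum>b\<in>B. c b *\<^sub>R b)"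
proof -
  obtain A :: "'a set" where A: "finite A" "span A = UNIV"
    using assms unfolding fin_dim_real_def by blast
  obtain B where B: "B \<subseteq> A" "independent B" "A \<subseteq> span B"
    using maximal_independent_subset[of A] by blast
  have "finite B"
    using A(1) B(1) by (rule finite_subset[rotated])
  moreover have "span B = UNIV"
    using span_minimal[OF B(3) subspace_span] A(2) by blast
  moreover obtain \<delta> where "\<delta> > 0" "\<And>c. \<delta> * (\<Sum>b\<in>B. \<bar>c b\<bar>) \<le> norm (\<Sum>b\<in>B. c b *\<^sub>R b)"
    using independent_coefficient_bound[OF \<open>finite B\<close> B(2)] by blast
  ultimately show ?thesis
    by (rule that)
qed

lemma fin_dim_real_Cauchy_convergent:
  fixes X :: "nat \<Rightarrow> 'a::real_normed_vector"
  assumes "fin_dim_real TYPE('a)" and "Cauchy X"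
  shows "convergent X"
proof -
  obtain B :: "'a set" and \<delta> where "finite B" "span B = UNIV" "\<delta> > 0"
    "\<And>c. \<delta> * (\<Sum>b\<in>B. \<bar>c b\<bar>) \<le> norm (\<Sum>b\<in>B. c b *\<^sub>R b)"
    using fin_dim_real_basis[OF assms(1)] by blast
  then have "complete (UNIV :: 'a set)"
    using complete_span_if_coefficient_bound by metis
  then show ?thesis
    using \<open>Cauchy X\<close> unfolding convergent_def by (blast elim: completeE)
qed

lemma fin_dim_real_norm_mult_bound:
  assumes "fin_dim_real TYPE('a)"
  obtains K where "K > 0" "\<And>x y :: 'a::{real_normed_vector,real_algebra}. norm (x * y) \<le> K * norm x * norm y"
proof -
  obtain B :: "'a set" and \<delta> where B: "finite B" "span B = UNIV" and \<delta>: "\<delta> > 0"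
    and bound: "\<And>c. \<delta> * (\<Sum>b\<in>B. \<bar>c b\<bar>) \<le> norm (\<Sum>b\<in>B. c b *\<^sub>R b)"
    using fin_dim_real_basis[OF assms] by blast
  have coordinates: "\<exists>c. x = (\<Sum>b\<in>B. c b *\<^sub>R b) \<and> (\<Sum>b\<in>B. \<bar>c b\<bar>) \<le> norm x / \<delta>" for x :: 'a
  proof -
    have "x \<in> span B"
      using B(2) by simp
    then obtain c where "x = (\<Sum>b\<in>B. c b *\<^sub>R b)"
      unfolding span_finite[OF B(1)] by blast
    with bound[of c] \<delta> show ?thesis
      by (auto simp: field_simps)
  qed
  define M where "M = (\<Sum>i\<in>B. \<Sum>j\<in>B. norm (i * j))"
  have M: "norm (i * j) \<le> M" if "i \<in> B" "j \<in> B" for i j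
  proof -
    have "norm (i * j) \<le> (\<Sum>j\<in>B. norm (i * j))"
      using that B(1) by (intro member_le_sum) auto
    also have "\<dots> \<le> M"
      unfolding M_def using that B(1) by (intro member_le_sum) (auto simp: sum_nonneg)
    finally show ?thesis .
  qed
  have M_nonneg: "M \<ge> 0"
    unfolding M_def by (simp add: sum_nonneg)
  show ?thesis
  proof (rule that)
    show "(M + 1) / \<delta>\<^sup>2 > 0"
      using M_nonneg \<delta> by simp
    fix x y :: 'a
    obtain d c where x: "x = (\<Sum>i\<in>B. d i *\<^sub>R i)" and dx: "(\<Sum>i\<in>B. \<bar>d i\<bar>) \<le> norm x / \<delta>"
      and y: "y = (\<Sum>j\<in>B. c j *\<^sub>R j)" and cy: "(\<Sum>j\<in>B. \<bar>c j\<bar>) \<le> norm y / \<delta>"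
      using coordinates by metis
    have "norm (x * y) = norm (\<Sum>i\<in>B. \<Sum>j\<in>B. (d i * c j) *\<^sub>R (i * j))"
      unfolding x y sum_product by (simp add: mult_scaleR_left mult_scaleR_right mult.commute)
    also have "\<dots> \<le> (\<Sum>i\<in>B. \<Sum>j\<in>B. norm ((d i * c j) *\<^sub>R (i * j)))"
      by (intro order.trans[OF norm_sum] sum_mono norm_sum)
    also have "\<dots> \<le> (\<Sum>i\<in>B. \<Sum>j\<in>B. \<bar>d i\<bar> * \<bar>c j\<bar> * (M + 1))"
    proof (intro sum_mono)
      fix i j
      assume "i \<in> B" "j \<in> B"
      then have "norm (i * j) \<le> M + 1"
        using M by fastforce
      then show "norm ((d i * c j) *\<^sub>R (i * j)) \<le> \<bar>d i\<bar> * \<bar>c j\<bar> * (M + 1)"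
        by (simp add: abs_mult mult_left_mono)
    qed
    also have "\<dots> = (M + 1) * ((\<Sum>i\<in>B. \<bar>d i\<bar>) * (\<Sum>j\<in>B. \<bar>c j\<bar>))"
      by (simp add: sum_product sum_distrib_left mult_ac)
    also have "\<dots> \<le> (M + 1) * ((norm x / \<delta>) * (norm y / \<delta>))"
      using dx cy M_nonneg \<delta> by (intro mult_left_mono mult_mono) (auto simp: sum_nonneg)
    also have "\<dots> = (M + 1) / \<delta>\<^sup>2 * norm x * norm y"
      by (simp add: field_simps power2_eq_square)
    finally show "norm (x * y) \<le> (M + 1) / \<delta>\<^sup>2 * norm x * norm y" .
  qed
qed

lemma uniform_limit_if_uniformly_Cauchy_on:
  fixes f :: "nat \<Rightarrow> 'a \<Rightarrow> 'b::metric_space"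
  assumes Cauchy: "uniformly_Cauchy_on S f" and lim: "\<And>x. x \<in> S \<Longrightarrow> (\<lambda>n. f n x) \<longlonglongrightarrow> g x"
  shows "uniform_limit S f g sequentially"
  unfolding uniform_limit_sequentially_iff
proof (intro allI impI)
  fix e :: real
  assume "e > 0"
  then obtain N where N: "\<And>x m n. x \<in> S \<Longrightarrow> m \<ge> N \<Longrightarrow> n \<ge> N \<Longrightarrow> dist (f m x) (f n x) < e / 2"
    using Cauchy unfolding uniformly_Cauchy_on_def by (meson half_gt_zero)
  have "dist (f n x) (g x) \<le> e / 2" if "n \<ge> N" "x \<in> S" for n x
  proof (rule tendsto_upperbound)
    show "(\<lambda>m. dist (f n x) (f m x)) \<longlonglongrightarrow> dist (f n x) (g x)"
      by (intro tendsto_intros lim \<open>x \<in> S\<close>)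
    show "\<forall>\<^sub>F m in sequentially. dist (f n x) (f m x) \<le> e / 2"
      unfolding eventually_sequentially using N \<open>x \<in> S\<close> \<open>n \<ge> N\<close> less_imp_le by blast
  qed simp
  moreover have "e / 2 < e"
    using \<open>e > 0\<close> by simp
  ultimately show "\<exists>N. \<forall>n\<ge>N. \<forall>x\<in>S. dist (f n x) (g x) < e"
    by (meson le_less_trans)
qed

lemma uniformly_Cauchy_on_if_Lipschitz_differences:
  fixes f :: "nat \<Rightarrow> 'a::real_normed_vector \<Rightarrow> 'b::real_normed_vector"
  assumes lip: "\<And>e. e > 0 \<Longrightarrow> \<exists>N. \<forall>m\<ge>N. \<forall>n\<ge>N. \<forall>x\<in>S. \<forall>y\<in>S.
      norm ((f m x - f n x) - (f m y - f n y)) \<le> e * norm (x - y)"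
    and "bounded S" and x0: "x0 \<in> S" and Cauchy: "Cauchy (\<lambda>n. f n x0)"
  shows "uniformly_Cauchy_on S f"
proof (rule uniformly_Cauchy_onI)
  fix e :: real
  assume e: "e > 0"
  obtain b where b: "b > 0" "\<And>x. x \<in> S \<Longrightarrow> norm x \<le> b"
    using \<open>bounded S\<close> unfolding bounded_pos by blast
  define R where "R = 2 * b"
  have R: "R > 0"
    using b(1) unfolding R_def by simp
  have R_bound: "norm (x - x0) \<le> R" if "x \<in> S" for x
    using norm_triangle_ineq4[of x x0] b(2)[OF that] b(2)[OF x0] unfolding R_def by linarith
  have "e / (2 * R) > 0"
    using e R by simp
  then obtain N1 where N1: "\<forall>m\<ge>N1. \<forall>n\<ge>N1. \<forall>x\<in>S. \<forall>y\<in>S.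
      norm ((f m x - f n x) - (f m y - f n y)) \<le> e / (2 * R) * norm (x - y)"
    using lip by blast
  obtain N2 where N2: "\<forall>m\<ge>N2. \<forall>n\<ge>N2. dist (f m x0) (f n x0) < e / 2"
    using Cauchy e unfolding Cauchy_def by (meson half_gt_zero)
  show "\<exists>M. \<forall>x\<in>S. \<forall>m\<ge>M. \<forall>n\<ge>M. dist (f m x) (f n x) < e"
  proof (intro exI ballI allI impI)
    fix x m n
    assume x: "x \<in> S" and mn: "max N1 N2 \<le> m" "max N1 N2 \<le> n"
    have "dist (f m x) (f n x) \<le> norm (f m x0 - f n x0) + norm ((f m x - f n x) - (f m x0 - f n x0))"
      unfolding dist_norm by (rule norm_triangle_sub)
    also have "norm ((f m x - f n x) - (f m x0 - f n x0)) \<le> e / (2 * R) * norm (x - x0)"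
      using N1 mn x x0 by simp
    also have "\<dots> \<le> e / (2 * R) * R"
      using R_bound[OF x] R e by (intro mult_left_mono) auto
    also have "norm (f m x0 - f n x0) < e / 2"
      using N2 mn by (simp add: dist_norm)
    finally show "dist (f m x) (f n x) < e"
      using R by simp
  qed
qed

lemma uniform_limit_of_uniformly_convergent_derivatives:
  fixes f :: "nat \<Rightarrow> 'a::real_normed_vector \<Rightarrow> 'b::real_normed_vector"
  assumes complete: "\<And>X :: nat \<Rightarrow> 'b. Cauchy X \<Longrightarrow> convergent X"
    and "convex S" "bounded S"
    and derf: "\<And>n x. x \<in> S \<Longrightarrow> (f n has_derivative f' n x) (at x within S)"
    and nle: "\<And>e. e > 0 \<Longrightarrow> \<forall>\<^sub>F n in sequentially. \<forall>x\<in>S. \<forall>h. norm (f' n x h - g' x h) \<le> e * norm h"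
    and "x0 \<in> S" and "convergent (\<lambda>n. f n x0)"
  shows "uniform_limit S f (\<lambda>x. lim (\<lambda>n. f n x)) sequentially"
proof (rule uniform_limit_if_uniformly_Cauchy_on)
  show Cauchy: "uniformly_Cauchy_on S f"
    using has_derivative_sequence_Lipschitz[OF \<open>convex S\<close> derf nle] \<open>bounded S\<close> \<open>x0 \<in> S\<close>
      \<open>convergent (\<lambda>n. f n x0)\<close>
    by (intro uniformly_Cauchy_on_if_Lipschitz_differences) (auto simp: convergent_def LIMSEQ_imp_Cauchy)
  show "(\<lambda>n. f n x) \<longlonglongrightarrow> lim (\<lambda>n. f n x)" if "x \<in> S" for x
    using complete[OF uniformly_Cauchy_imp_Cauchy[OF Cauchy that]]
    by (simp add: convergent_LIMSEQ_iff)
qed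

lemma has_derivative_of_uniformly_convergent_derivatives:
  fixes f :: "nat \<Rightarrow> 'a::real_normed_vector \<Rightarrow> 'b::real_normed_vector"
  assumes "convex S"
    and derf: "\<And>n x. x \<in> S \<Longrightarrow> (f n has_derivative f' n x) (at x within S)"
    and nle: "\<And>e. e > 0 \<Longrightarrow> \<forall>\<^sub>F n in sequentially. \<forall>x\<in>S. \<forall>h. norm (f' n x h - g' x h) \<le> e * norm h"
    and lim: "\<And>x. x \<in> S \<Longrightarrow> (\<lambda>n. f n x) \<longlonglongrightarrow> g x"
    and x: "x \<in> S" and "bounded_linear (g' x)"
  shows "(g has_derivative g' x) (at x within S)"
  unfolding has_derivative_within_alt2
proof (intro conjI allI impI)
  fix e :: real
  assume "e > 0"
  then have e3: "e / 3 > 0" by simp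
  obtain N1 where N1: "\<And>n h. n \<ge> N1 \<Longrightarrow> norm (f' n x h - g' x h) \<le> e / 3 * norm h"
    using nle[OF e3] x unfolding eventually_sequentially by blast
  obtain N2 where N2: "\<forall>m\<ge>N2. \<forall>n\<ge>N2. \<forall>x\<in>S. \<forall>y\<in>S.
      norm ((f m x - f n x) - (f m y - f n y)) \<le> e / 3 * norm (x - y)"
    using has_derivative_sequence_Lipschitz[OF \<open>convex S\<close> derf nle e3] by blast
  define N where "N = max N1 N2"
  have limit_diff: "norm ((g y - g x) - (f N y - f N x)) \<le> e / 3 * norm (y - x)" if y: "y \<in> S" for y
  proof (rule tendsto_upperbound)
    have "(\<lambda>m. (f m y - f N y) - (f m x - f N x)) \<longlonglongrightarrow> (g y - f N y) - (g x - f N x)"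
      by (intro tendsto_diff lim x y tendsto_const)
    moreover have "(g y - f N y) - (g x - f N x) = (g y - g x) - (f N y - f N x)"
      by (simp add: algebra_simps)
    ultimately show "(\<lambda>m. norm ((f m y - f N y) - (f m x - f N x))) \<longlonglongrightarrow> norm ((g y - g x) - (f N y - f N x))"
      by (metis tendsto_norm)
    show "\<forall>\<^sub>F m in sequentially. norm ((f m y - f N y) - (f m x - f N x)) \<le> e / 3 * norm (y - x)"
    proof (rule eventually_sequentiallyI)
      fix m
      assume "N \<le> m"
      then show "norm ((f m y - f N y) - (f m x - f N x)) \<le> e / 3 * norm (y - x)"
        using N2 x y unfolding N_def by simp
    qed
  qed simp
  have "\<forall>\<^sub>F y in at x within S. norm (f N y - f N x - f' N x (y - x)) \<le> e / 3 * norm (y - x)"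
    using derf[OF x, of N] e3 unfolding has_derivative_within_alt2 by blast
  moreover have "\<forall>\<^sub>F y in at x within S. y \<in> S"
    unfolding eventually_at by (fast intro: zero_less_one)
  ultimately show "\<forall>\<^sub>F y in at x within S. norm (g y - g x - g' x (y - x)) \<le> e * norm (y - x)"
  proof eventually_elim
    case (elim y)
    have "g y - g x - g' x (y - x) = ((g y - g x) - (f N y - f N x))
        + (f N y - f N x - f' N x (y - x)) + (f' N x (y - x) - g' x (y - x))"
      by (simp add: algebra_simps)
    also have "norm \<dots> \<le> e / 3 * norm (y - x) + e / 3 * norm (y - x) + e / 3 * norm (y - x)"
      using limit_diff[OF \<open>y \<in> S\<close>] elim(1) N1[of N] unfolding N_def
      by (intro norm_triangle_le add_mono) auto
    finally show ?case by simp
  qed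
qed fact

lemma A_differentiable_imp_has_derivative:
  assumes "A_differentiable f z"
  shows "(f has_derivative (\<lambda>h. A_deriv f z * h)) (at z)"
proof -
  obtain T where T: "right_A_linear T" "(f has_derivative T) (at z)"
    using assms unfolding A_differentiable_def by blast
  have deriv: "A_deriv f z = T 1"
    unfolding A_deriv_def using frechet_derivative_at[OF T(2)] by simp
  have T_mult: "T h = T 1 * h" for h
  proof -
    have "T (1 * h) = T 1 * h"
      using T(1) unfolding right_A_linear_def by blast
    then show ?thesis
      by simp
  qed
  have "(\<lambda>h. A_deriv f z * h) = T"
  proof
    show "A_deriv f z * h = T h" for h
      by (simp only: deriv T_mult[of h])
  qed
  with T(2) show ?thesis
    by simp
qed

lemma A_differentiableI:
  assumes "(f has_derivative (\<lambda>h. c * h)) (at z)"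
  shows "A_differentiable f z"
proof -
  have "right_A_linear (\<lambda>h. c * h)"
    using has_derivative_linear[OF assms] unfolding right_A_linear_def by (simp add: mult.assoc)
  with assms show ?thesis
    unfolding A_differentiable_def by blast
qed

lemma A_deriv_eqI:
  assumes "(f has_derivative (\<lambda>h. c * h)) (at z)"
  shows "A_deriv f z = c"
  unfolding A_deriv_def frechet_derivative_at[OF assms, symmetric] by simp

lemma uniform_limit_mult_right_eventually_le:
  fixes D :: "nat \<Rightarrow> 'b \<Rightarrow> 'a::{real_normed_vector,real_algebra}"
  assumes K: "K > 0" "\<And>x y :: 'a. norm (x * y) \<le> K * norm x * norm y"
    and lim: "uniform_limit S D G sequentially" and "e > 0"
  shows "\<forall>\<^sub>F n in sequentially. \<forall>x\<in>S. \<forall>h. norm (D n x * h - G x * h) \<le> e * norm h"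
proof -
  have "\<forall>\<^sub>F n in sequentially. \<forall>x\<in>S. dist (D n x) (G x) < e / K"
    using lim \<open>e > 0\<close> K(1) unfolding uniform_limit_iff by simp
  then show ?thesis
  proof (rule eventually_mono, intro ballI allI)
    fix n x h
    assume "\<forall>x\<in>S. dist (D n x) (G x) < e / K" and "x \<in> S"
    then have "norm (D n x - G x) \<le> e / K"
      by (simp add: dist_norm less_imp_le)
    have "norm (D n x * h - G x * h) = norm ((D n x - G x) * h)"
      by (simp add: left_diff_distrib)
    also have "\<dots> \<le> K * norm (D n x - G x) * norm h"
      by (rule K(2))
    also have "\<dots> \<le> K * (e / K) * norm h"
      using \<open>norm (D n x - G x) \<le> e / K\<close> K(1) by (intro mult_right_mono mult_left_mono) auto
    finally show "norm (D n x * h - G x * h) \<le> e * norm h"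
      using K(1) by simp
  qed
qed

lemma A_differentiable_limit_on_ball:
  fixes f :: "nat \<Rightarrow> 'a \<Rightarrow> 'a::{real_algebra_1,real_normed_vector}"
  assumes fin: "fin_dim_real TYPE('a)"
    and diff: "\<And>n z. z \<in> ball a r \<Longrightarrow> A_differentiable (f n) z"
    and "\<exists>G. uniform_limit (ball a r) (\<lambda>n z. A_deriv (f n) z) G sequentially"
    and x0: "x0 \<in> ball a r" and conv: "convergent (\<lambda>n. f n x0)"
  shows "uniform_limit (ball a r) f (\<lambda>z. lim (\<lambda>n. f n z)) sequentially \<and>
    (\<forall>z\<in>ball a r. A_differentiable (\<lambda>w. lim (\<lambda>n. f n w)) z \<and>
      A_deriv (\<lambda>w. lim (\<lambda>n. f n w)) z = lim (\<lambda>n. A_deriv (f n) z))"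
proof (intro conjI ballI)
  obtain G where unif: "uniform_limit (ball a r) (\<lambda>n z. A_deriv (f n) z) G sequentially"
    using assms(3) by blast
  obtain K where K: "K > 0" "\<And>x y :: 'a. norm (x * y) \<le> K * norm x * norm y"
    using fin_dim_real_norm_mult_bound[OF fin] by blast
  have derf: "(f n has_derivative (\<lambda>h. A_deriv (f n) x * h)) (at x within ball a r)"
    if "x \<in> ball a r" for n x
    using A_differentiable_imp_has_derivative[OF diff[OF that]] by (rule has_derivative_at_withinI)
  note nle = uniform_limit_mult_right_eventually_le[OF K unif]
  show uniform: "uniform_limit (ball a r) f (\<lambda>z. lim (\<lambda>n. f n z)) sequentially"
    by (rule uniform_limit_of_uniformly_convergent_derivatives[OF fin_dim_real_Cauchy_convergent[OF fin]
          convex_ball bounded_ball derf nle x0 conv])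
  fix z
  assume z: "z \<in> ball a r"
  have "bounded_linear (\<lambda>h. G z * h)"
  proof (rule bounded_linear_intro)
    show "norm (G z * h) \<le> norm h * (K * norm (G z))" for h
      using K(2)[of "G z" h] by (simp add: mult_ac)
  qed (simp_all add: distrib_left)
  then have "((\<lambda>w. lim (\<lambda>n. f n w)) has_derivative (\<lambda>h. G z * h)) (at z within ball a r)"
    using tendsto_uniform_limitI[OF uniform]
    by (intro has_derivative_of_uniformly_convergent_derivatives[OF convex_ball derf nle _ z])
  moreover have "G z = lim (\<lambda>n. A_deriv (f n) z)"
    using limI[OF tendsto_uniform_limitI[OF unif z]] by simp
  ultimately have "((\<lambda>w. lim (\<lambda>n. f n w)) has_derivative (\<lambda>h. lim (\<lambda>n. A_deriv (f n) z) * h)) (at z)"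
    by (simp add: at_within_open[OF z open_ball])
  then show "A_differentiable (\<lambda>w. lim (\<lambda>n. f n w)) z"
    and "A_deriv (\<lambda>w. lim (\<lambda>n. f n w)) z = lim (\<lambda>n. A_deriv (f n) z)"
    by (rule A_differentiableI, rule A_deriv_eqI)
qed

theorem theorem5p19:
  fixes U :: "'a::{real_algebra_1,real_normed_vector} set"
    and f :: "nat \<Rightarrow> 'a \<Rightarrow> 'a"
    and z0 :: 'a
    and rad :: "'a \<Rightarrow> real"
  assumes fin: "fin_dim_real TYPE('a)"
    and U_open: "open U" and U_conn: "connected U"
    and f_diff: "\<And>n z. z \<in> U \<Longrightarrow> A_differentiable (f n) z"
    and z0: "z0 \<in> U" and conv_z0: "convergent (\<lambda>n. f n z0)"
    and balls: "\<And>a. a \<in> U \<Longrightarrow> rad a > 0 \<and> ball a (rad a) \<subseteq> U \<and>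
         (\<exists>h. uniform_limit (ball a (rad a)) (\<lambda>n z. A_deriv (f n) z) h sequentially)"
  shows "(\<forall>a\<in>U. \<exists>F. uniform_limit (ball a (rad a)) f F sequentially) \<and>
         (\<forall>z\<in>U. A_differentiable (\<lambda>w. lim (\<lambda>n. f n w)) z \<and>
                 A_deriv (\<lambda>w. lim (\<lambda>n. f n w)) z = lim (\<lambda>n. A_deriv (f n) z))"
proof -
  have on_ball: "uniform_limit (ball a (rad a)) f (\<lambda>z. lim (\<lambda>n. f n z)) sequentially \<and>
      (\<forall>z\<in>ball a (rad a). A_differentiable (\<lambda>w. lim (\<lambda>n. f n w)) z \<and>
        A_deriv (\<lambda>w. lim (\<lambda>n. f n w)) z = lim (\<lambda>n. A_deriv (f n) z))"
    if "a \<in> U" "x0 \<in> ball a (rad a)" "convergent (\<lambda>n. f n x0)" for a x0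
    by (rule A_differentiable_limit_on_ball[OF fin]) (use balls[OF that(1)] f_diff that in blast)+
  have convergent: "convergent (\<lambda>n. f n z)" if "z \<in> U" for z
  proof (rule connected_induction_simple[where P="\<lambda>z. convergent (\<lambda>n. f n z)", OF U_conn z0 that conv_z0])
    fix a
    assume a: "a \<in> U"
    show "\<exists>T. openin (top_of_set U) T \<and> a \<in> T \<and>
        (\<forall>x\<in>T. \<forall>y\<in>T. convergent (\<lambda>n. f n x) \<longrightarrow> convergent (\<lambda>n. f n y))"
    proof (intro exI conjI ballI impI)
      show "openin (top_of_set U) (ball a (rad a))" "a \<in> ball a (rad a)"
        using balls[OF a] by (simp_all add: open_subset)
      show "convergent (\<lambda>n. f n y)"
        if "x \<in> ball a (rad a)" "y \<in> ball a (rad a)" "convergent (\<lambda>n. f n x)" for x y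
        using tendsto_uniform_limitI[OF conjunct1[OF on_ball[OF a that(1,3)]] that(2)]
        by (rule convergentI)
    qed
  qed
  have "a \<in> ball a (rad a)" if "a \<in> U" for a
    using balls[OF that] by simp
  then show ?thesis
    using on_ball convergent by blast
qed

end
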